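(* Let $p$ be a prime, $k$ a positive integer, $\theta(p,j)=\frac{p^j-1}{p-1}$, and let $\chi\in\mathbb{Z}^{\theta(p,k)}$. The procedure described in the context, which on input $(p,k,\chi)$ computes the $\theta(p,k)\times p$ integer matrix $M_k^{[\chi]}$ in steps $l=2,\dots,k$, has complexity $$\sum_{l=2}^k \frac{p^{k+2}-p^{k+2-l}+p^{k-1}-p^{k-l}}{p-1}=(k-1)\frac{p^{k+2}+p^{k-1}}{p-1}-\frac{(p^2+1)(p^{k-1}-1)}{(p-1)^2}.$$ Consequently, for a fixed $p$ the complexity of this procedure is $O(kp^k)$, and when accounting for both $k$ and $p$, its running time in terms of arithmetic operations is $O(kp^{k+1})$.
   Context: Write $\theta_j=\theta(p,j)$, so $\theta_j=p\theta_{j-1}+1$ for $j\ge 2$, and $\mathbb{F}_p=\{0,1,\dots,p-1\}$. **The matrix computed.** The $k\times\theta_k$ matrices $G_k$ over $\mathbb{F}_p$ are defined by $G_1=(1)$ and, for $k\ge2$, $$G_{k}=\left(\begin{array}{ccccc}\mathbf{0}&\mathbf{1}&\ldots&\mathbf{p-1}&1\\ G_{k-1}&G_{k-1}&\ldots&G_{k-1}&\mathbf{0}^{\mathrm T}\end{array}\right),$$ where in the first row $\mathbf{u}=(u,\dots,u)$ is a constant row vector of length $\theta_{k-1}$. Put $M_k=G_k^{\mathrm T}G_k=(m_{ij})$ over $\mathbb{F}_p$. For $\chi=(\chi_1,\dots,\chi_{\theta_k})\in\mathbb{Z}^{\theta_k}$, $M_k^{[\chi]}$ is the $\theta_k\times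 p$ integer matrix whose $i$-th row is $(\omega_0^{(i)},\ldots,\omega_{p-1}^{(i)})$ with $\omega_u^{(i)}=\sum\{\chi_j : 1\le j\le\theta_k,\ m_{ij}=u\}$. (If $\chi$ is the characteristic vector of an $[n,k]$ linear code over $\mathbb{F}_p$, i.e. $\chi_u$ is the number of columns of a generator matrix without zero columns that are proportional to the $u$-th column of $G_k$, then the numbers $n-\omega_0^{(i)}$ are the weights of a maximal set of pairwise nonproportional nonzero codewords.) **The procedure.** It works on an integer array $H$ with rows $H[1],\dots,H[\theta_k]$, each of length $p$ with entries $H[i,0],\dots,H[i,p-1]$. Let $\sigma$ be the right circular shift and $\mathrm{lcs}$ the left circular shift by one position of a vector of length $p$. Initially $H[i]=(0,\chi_i,0,\dots,0)$ for all $i$. For $l=2,\dots,k$ do the following. Set an array $a$ with positions $1,\dots,k$ to zero, and $r:=0$. While $r<\theta_k$: put $r_0:=r$ and $r:=r+\theta_l$; update the block of rows $r_0+1,\dots,r$ as described below; put $s:=l$, $a[s]:=a[s]+1$; and while $a[s]=p$, put $r:=r+1$ (this skips one row, called inactive, which is left unchanged), $a[s]:=0$, $s:=s+1$, $a[s]:=a[s]+1$. After the last step $l=k$, $H=M_k^{[\chi]}$. The update of a block, with $\theta=\theta_{l-1}$, is: (i) Add0: $H[r_0+\theta+i]:=H[r_0+\theta+i]+\mathrm{lcs}(H[r])$ for $i=1,\dots,\theta$ (here $H[r]$ has the form $(0,x,0,\dots,0)$, so $\mathrm{lcs}(H[r])=(x,0,\dots,0)$); (ii) LastRow: $H[r]:=\left(\sum_{i=0}^{p-1}H[r_0+1,i],\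 \sum_{i=0}^{p-1}H[r_0+\theta+1,i],\ \ldots,\ \sum_{i=0}^{p-1}H[r_0+(p-1)\theta+1,i]\right)$; (iii) AllRows: for $i=1,\dots,\theta$, save $T[j]:=H[r_0+j\theta+i]$ for $j=0,\dots,p-1$, and then put $H[r_0+j\theta+i]:=T[0]+\sigma^{j}(T[1])+\cdots+\sigma^{j(p-1)}(T[p-1])$ for $j=0,1,\dots,p-1$. **Counting of operations.** In step $l$ there are $p^{k-l}\theta_l$ active rows (rows belonging to updated blocks) and $\theta_{k-l}$ inactive rows. Each of the $p$ entries of an active row is computed in LastRow or AllRows as a sum with $p$ summands, which is counted as $p$ operations, so these two transformations together count $p^{k-l}\theta_l\,p^2$ operations. Add0 counts $p^{k-l}\theta_{l-1}$ operations. The complexity of step $l$ is the sum of these two numbers, and the complexity of the procedure is the total over $l=2,\dots,k$. *)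

theory Defs
  imports
    "Jordan_Normal_Form.Matrix"
    "HOL-Computational_Algebra.Primes"
    "HOL-Library.Landau_Symbols"
    "HOL-Library.While_Combinator"
begin

(* The division is exact, since p - 1 divides p^j - 1. *)
definition \<theta> :: "nat \<Rightarrow> nat \<Rightarrow> nat" where
  "\<theta> p j = (p ^ j - 1) div (p - 1)"

(* Elements of the prime field are represented by the naturals 0, ..., p - 1.
   Matrices and vectors are indexed from 0, so column j of the paper is column j - 1 here.
   The case k = 0 is irrelevant. *)
fun G :: "nat \<Rightarrow> nat \<Rightarrow> nat mat" where
  "G p 0 = 0\<^sub>m 0 0"
| "G p (Suc 0) = 1\<^sub>m 1"
| "G p (Suc (Suc k)) =
    (let t = \<theta> p (Suc k) in
     mat (Suc (Suc k)) (\<theta> p (Suc (Suc k)))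
       (\<lambda>(i, j). if i = 0 then (if j < p * t then j div t else 1)
                 else (if j < p * t then G p (Suc k) $$ (i - 1, j mod t) else 0)))"

definition M :: "nat \<Rightarrow> nat \<Rightarrow> nat mat" where
  "M p k = map_mat (\<lambda>x. x mod p) (transpose_mat (G p k) * G p k)"

definition M_char :: "nat \<Rightarrow> nat \<Rightarrow> int vec \<Rightarrow> int mat" where
  "M_char p k \<chi> = mat (\<theta> p k) p
     (\<lambda>(i, u). \<Sum>j \<in> {j. j < \<theta> p k \<and> M p k $$ (i, j) = u}. \<chi> $ j)"

(* The array H of the procedure: H i u is the entry H[i,u]. Rows are numbered from 1 as in
   the paper; only the rows 1, ..., \<theta> p k and the entries u < p are meaningful. *)
type_synonym rows = "nat \<Rightarrow> nat \<Rightarrow> int"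

(* The array together with the number of operations performed so far. *)
type_synonym counted_rows = "rows \<times> nat"

definition lcs :: "nat \<Rightarrow> (nat \<Rightarrow> int) \<Rightarrow> nat \<Rightarrow> int" where
  "lcs p v = (\<lambda>u. v ((u + 1) mod p))"

definition rcs :: "nat \<Rightarrow> (nat \<Rightarrow> int) \<Rightarrow> nat \<Rightarrow> int" where
  "rcs p v = (\<lambda>u. v ((u + p - 1) mod p))"

(* In the updates below, t stands for \<theta> p (l - 1). *)

(* Adding lcs (H[r]) to a row counts as one operation: on the reachable arrays
   lcs (H[r]) has the form (x, 0, ..., 0). *)
definition add0_row :: "nat \<Rightarrow> nat \<Rightarrow> nat \<Rightarrow> nat \<Rightarrow> nat \<Rightarrow> counted_rows \<Rightarrow> counted_rows" where
  "add0_row p t r0 r i = (\<lambda>(H, c).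
     (H(r0 + t + i := (\<lambda>u. H (r0 + t + i) u + lcs p (H r) u)), c + 1))"

definition add0 :: "nat \<Rightarrow> nat \<Rightarrow> nat \<Rightarrow> nat \<Rightarrow> counted_rows \<Rightarrow> counted_rows" where
  "add0 p t r0 r = fold (add0_row p t r0 r) [1..<t + 1]"

(* In LastRow and AllRows every new entry is the sum of an explicit list of summands, and
   computing it counts as many operations as the list has elements. *)
definition last_row_summands :: "nat \<Rightarrow> nat \<Rightarrow> nat \<Rightarrow> rows \<Rightarrow> nat \<Rightarrow> int list" where
  "last_row_summands p t r0 H j = map (\<lambda>i. H (r0 + j * t + 1) i) [0..<p]"

definition last_row :: "nat \<Rightarrow> nat \<Rightarrow> nat \<Rightarrow> nat \<Rightarrow> counted_rows \<Rightarrow> counted_rows" where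
  "last_row p t r0 r = (\<lambda>(H, c).
     (H(r := (\<lambda>j. sum_list (last_row_summands p t r0 H j))),
      c + (\<Sum>j<p. length (last_row_summands p t r0 H j))))"

definition all_rows_summands :: "nat \<Rightarrow> rows \<Rightarrow> nat \<Rightarrow> nat \<Rightarrow> int list" where
  "all_rows_summands p T j u = map (\<lambda>q. (rcs p ^^ (j * q)) (T q) u) [0..<p]"

definition all_rows_put ::
    "nat \<Rightarrow> nat \<Rightarrow> nat \<Rightarrow> nat \<Rightarrow> rows \<Rightarrow> nat \<Rightarrow> counted_rows \<Rightarrow> counted_rows" where
  "all_rows_put p t r0 i T j = (\<lambda>(H, c).
     (H(r0 + j * t + i := (\<lambda>u. sum_list (all_rows_summands p T j u))),
      c + (\<Sum>u<p. length (all_rows_summands p T j u))))"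

definition all_rows_at :: "nat \<Rightarrow> nat \<Rightarrow> nat \<Rightarrow> nat \<Rightarrow> counted_rows \<Rightarrow> counted_rows" where
  "all_rows_at p t r0 i = (\<lambda>(H, c).
     let T = (\<lambda>j. H (r0 + j * t + i))
     in fold (all_rows_put p t r0 i T) [0..<p] (H, c))"

definition all_rows :: "nat \<Rightarrow> nat \<Rightarrow> nat \<Rightarrow> counted_rows \<Rightarrow> counted_rows" where
  "all_rows p t r0 = fold (all_rows_at p t r0) [1..<t + 1]"

definition update_block :: "nat \<Rightarrow> nat \<Rightarrow> nat \<Rightarrow> nat \<Rightarrow> counted_rows \<Rightarrow> counted_rows" where
  "update_block p t r0 r Hc = all_rows p t r0 (last_row p t r0 r (add0 p t r0 r Hc))"

(* The inner loop, acting on (r, a, s); it skips the inactive rows. *)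
definition skip_inactive ::
    "nat \<Rightarrow> nat \<times> (nat \<Rightarrow> nat) \<times> nat \<Rightarrow> nat \<times> (nat \<Rightarrow> nat) \<times> nat" where
  "skip_inactive p = while (\<lambda>(r, a, s). a s = p)
     (\<lambda>(r, a, s). (r + 1, a(s := 0, s + 1 := a (s + 1) + 1), s + 1))"

definition block_body ::
    "nat \<Rightarrow> nat \<Rightarrow> counted_rows \<times> nat \<times> (nat \<Rightarrow> nat) \<Rightarrow> counted_rows \<times> nat \<times> (nat \<Rightarrow> nat)" where
  "block_body p l = (\<lambda>(Hc, r0, a).
     let r = r0 + \<theta> p l;
         Hc' = update_block p (\<theta> p (l - 1)) r0 r Hc;
         (r', a', s') = skip_inactive p (r, a(l := a l + 1), l)
     in (Hc', r', a'))"

definition step :: "nat \<Rightarrow> nat \<Rightarrow> nat \<Rightarrow> counted_rows \<Rightarrow> counted_rows" where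
  "step p k l Hc =
     fst (while (\<lambda>(Hc, r, a). r < \<theta> p k) (block_body p l) (Hc, 0, (\<lambda>_. 0)))"

definition init_rows :: "int vec \<Rightarrow> rows" where
  "init_rows \<chi> = (\<lambda>i u. if u = 1 then \<chi> $ (i - 1) else 0)"

definition run :: "nat \<Rightarrow> nat \<Rightarrow> int vec \<Rightarrow> counted_rows" where
  "run p k \<chi> = fold (step p k) [2..<k + 1] (init_rows \<chi>, 0)"

definition procedure_result :: "nat \<Rightarrow> nat \<Rightarrow> int vec \<Rightarrow> int mat" where
  "procedure_result p k \<chi> = mat (\<theta> p k) p (\<lambda>(i, u). fst (run p k \<chi>) (i + 1) u)"

definition complexity :: "nat \<Rightarrow> nat \<Rightarrow> int vec \<Rightarrow> nat" where
  "complexity p k \<chi> = snd (run p k \<chi>)"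

end

(* The array a is a base p counter of the blocks finished so far, and a row is skipped at every
   carry. Hence block b of step l starts after b theta_l + (b div p + b div p^2 + ...) rows, and
   blocks pb, ..., pb + p - 1 of step l - 1, followed by one row that was inactive in that step,
   form block b of step l. Within a block, the recursion for G gives, for M = M_{l-1},
   M_l[(u,i),(v,j)] = uv + M[i,j], M_l[(u,i),last] = u and M_l[last,last] = 1 modulo p. So row
   (u,i) of the new matrix is the sum over v of row i for the v-th sub-block, shifted by uv,
   plus chi_last at position u; placing chi_last at position 0 of the sub-block v = 1 before the
   shifts (Add0) accounts for the last term, and makes the row sums (LastRow) come out right. *)
theory Submission
  imports Defs
begin

section \<open>The numbers \<open>\<theta> p j\<close> and their recursion\<close>

text \<open>The division in the definition of \<open>\<theta>\<close> is exact; this product form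
  lets later arguments avoid \<open>div\<close>.\<close>

lemma theta_mult:
  assumes "2 \<le> p"
  shows "(p - 1) * \<theta> p j + 1 = p ^ j"
proof -
  have "\<exists>q. p ^ j = (p - 1) * q + 1"
  proof (induction j)
    case 0
    show ?case by simp
  next
    case (Suc j)
    then obtain q where q: "p ^ j = (p - 1) * q + 1" by blast
    obtain m where m: "p = Suc m" using assms by (cases p) auto
    have "p ^ Suc j = (p - 1) * (p * q + 1) + 1"
      using q by (simp add: m algebra_simps)
    then show ?case by blast
  qed
  then obtain q where "p ^ j = (p - 1) * q + 1" by blast
  then show ?thesis using assms by (simp add: \<theta>_def)
qed

lemma theta_0 [simp]: "\<theta> p 0 = 0"
  by (simp add: \<theta>_def)

lemma theta_Suc:
  assumes "2 \<le> p"
  shows "\<theta> p (Suc j) = p * \<theta> p j + 1"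
proof -
  have "(p - 1) * \<theta> p (Suc j) + 1 = p * ((p - 1) * \<theta> p j + 1)"
    using assms by (simp only: theta_mult power_Suc)
  also have "\<dots> = (p - 1) * (p * \<theta> p j + 1) + 1"
    using assms by (cases p) (simp_all add: algebra_simps)
  finally have "(p - 1) * \<theta> p (Suc j) = (p - 1) * (p * \<theta> p j + 1)" by linarith
  then show ?thesis using assms by (subst (asm) mult_cancel1) simp
qed

lemma theta_1: "2 \<le> p \<Longrightarrow> \<theta> p (Suc 0) = 1"
  by (simp add: theta_Suc)

lemma theta_pos: "2 \<le> p \<Longrightarrow> 1 \<le> l \<Longrightarrow> 0 < \<theta> p l"
  by (cases l) (auto simp: theta_Suc)

lemma real_theta:
  assumes "2 \<le> p"
  shows "real (\<theta> p j) = (real p ^ j - 1) / (real p - 1)"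
proof -
  have "(real p - 1) * real (\<theta> p j) + 1 = real p ^ j"
    using theta_mult[OF assms, of j] assms
    by (metis (no_types, opaque_lifting) Suc_1 Suc_leD Suc_le_eq of_nat_1 of_nat_add of_nat_diff
        of_nat_mult of_nat_power One_nat_def)
  then show ?thesis using assms by (simp add: field_simps)
qed

section \<open>Carries of a base \<open>p\<close> counter and the positions of the blocks\<close>

text \<open>Legendre's sum \<open>b div p + b div p ^ 2 + ...\<close>, for prime \<open>p\<close>
  the exponent of \<open>p\<close> in the factorial of \<open>b\<close>. The guard
  \<open>p < 2\<close> secures termination, since \<open>b div 1 = b\<close>.\<close>

fun carry_sum :: "nat \<Rightarrow> nat \<Rightarrow> nat" where
  "carry_sum p b = (if p < 2 \<or> b = 0 then 0 else b div p + carry_sum p (b div p))"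

declare carry_sum.simps [simp del]

lemma carry_sum_0 [simp]: "carry_sum p 0 = 0"
  by (simp add: carry_sum.simps)

lemma carry_sum_digit:
  assumes "2 \<le> p" "j < p"
  shows "carry_sum p (p * b + j) = b + carry_sum p b"
proof -
  have "(p * b + j) div p = b" using assms by simp
  then show ?thesis using assms
    by (cases "p * b + j = 0") (simp_all add: carry_sum.simps[of p "p * b + j"] del: mult_eq_0_iff)
qed

text \<open>The quotients of \<open>b\<close> and \<open>Suc b\<close> by \<open>p\<close> are equal
  or consecutive, so the induction hypothesis for \<open>b div p\<close> suffices.\<close>

lemma carry_sum_mono: "carry_sum p b \<le> carry_sum p (Suc b)"
proof (induction p b rule: carry_sum.induct)
  case (1 p b)
  show ?case
  proof (cases "p < 2 \<or> b = 0")
    case True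
    then show ?thesis by (auto simp: carry_sum.simps[of p b])
  next
    case False
    have "Suc b div p = b div p \<or> Suc b div p = Suc (b div p)"
      by (simp add: div_Suc)
    then have "carry_sum p (b div p) \<le> carry_sum p (Suc b div p)"
      using 1 False by auto
    moreover have "b div p \<le> Suc b div p" by (simp add: div_le_mono)
    ultimately have "b div p + carry_sum p (b div p) \<le> Suc b div p + carry_sum p (Suc b div p)"
      by (intro add_mono)
    then show ?thesis
      using False by (simp add: carry_sum.simps[of p b] carry_sum.simps[of p "Suc b"])
  qed
qed

text \<open>The value of \<open>r\<^sub>0\<close> at block number \<open>b\<close> (counted from 0) of step \<open>l\<close>: above it lie \<open>b\<close> active
  blocks, and one inactive row for each pair of some \<open>i > 0\<close> and a positive multiple of \<open>p ^ i\<close> up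
  to \<open>b\<close>, since a row is skipped at every carry of the base \<open>p\<close> counter.\<close>

definition block_start :: "nat \<Rightarrow> nat \<Rightarrow> nat \<Rightarrow> nat" where
  "block_start p l b = b * \<theta> p l + carry_sum p b"

lemma block_start_0 [simp]: "block_start p l 0 = 0"
  by (simp add: block_start_def)

text \<open>A carry occurs only after the last of \<open>p\<close> such blocks, so these follow one
  another without a gap. This is how the blocks of step \<open>l\<close> nest in those of step
  \<open>Suc l\<close>.\<close>

lemma block_start_digit:
  assumes "2 \<le> p" "j < p"
  shows "block_start p l (p * b + j) = block_start p (Suc l) b + j * \<theta> p l"
  unfolding block_start_def carry_sum_digit[OF assms] theta_Suc[OF assms(1)]
  by (simp add: algebra_simps)

text \<open>Serves to keep the blocks of one step disjoint; rows skipped in between only enlarge the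
  gap, by \<open>carry_sum_mono\<close>.\<close>

lemma block_start_less:
  assumes "b < c"
  shows "block_start p l b + \<theta> p l \<le> block_start p l c"
  using assms
proof (induction c)
  case 0
  then show ?case by simp
next
  case (Suc c)
  have "block_start p l c + \<theta> p l \<le> block_start p l (Suc c)"
    using carry_sum_mono[of p c] by (simp add: block_start_def)
  with Suc show ?case by (cases "b = c") auto
qed

text \<open>The strict inequality matters: the last row of a block of step \<open>Suc l\<close> lies
  in none of its sub-blocks, so it still has its initial value when Add0 reads it.\<close>

lemma block_subset_next_block:
  assumes "2 \<le> p"
  shows "block_start p (Suc l) (b div p) \<le> block_start p l b"
    and "block_start p l b + \<theta> p l < block_start p (Suc l) (b div p) + \<theta> p (Suc l)"
proof -
  have j: "b mod p < p" using assms by simp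
  have s: "block_start p l b = block_start p (Suc l) (b div p) + b mod p * \<theta> p l"
    using block_start_digit[OF assms j, of l "b div p"] by simp
  have "b mod p * \<theta> p l + \<theta> p l \<le> p * \<theta> p l"
    using j mult_le_mono1[of "Suc (b mod p)" p "\<theta> p l"] by simp
  then show "block_start p (Suc l) (b div p) \<le> block_start p l b"
    and "block_start p l b + \<theta> p l < block_start p (Suc l) (b div p) + \<theta> p (Suc l)"
    using s unfolding theta_Suc[OF assms] by linarith+
qed

text \<open>With \<open>n = k - l\<close> this is the exit of the loop over the blocks. Each factor
  \<open>p\<close> is traded for one step by \<open>block_start_digit\<close> with
  \<open>j = 0\<close>.\<close>

lemma block_start_total:
  assumes "2 \<le> p"
  shows "block_start p l (p ^ n) = \<theta> p (l + n)"
proof (induction n arbitrary: l)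
  case 0
  show ?case using assms carry_sum_digit[of p 1 0]
    by (simp add: block_start_def carry_sum_0)
next
  case (Suc n)
  show ?case
    using block_start_digit[of p 0 l "p ^ n"] Suc[of "Suc l"] assms by simp
qed

section \<open>The counter array and the loop over the blocks\<close>

text \<open>The least significant digit stands at \<open>s\<close>. The position is a parameter
  because after a carry the digits from \<open>Suc s\<close> on act as a counter for
  \<open>b div p\<close>.\<close>

definition digits :: "nat \<Rightarrow> nat \<Rightarrow> nat \<Rightarrow> (nat \<Rightarrow> nat) \<Rightarrow> bool" where
  "digits p s b a \<longleftrightarrow> (\<forall>i. a (s + i) = b div p ^ i mod p)"

text \<open>Strong induction on \<open>b\<close>: without a carry the loop stops at once, and with
  one it continues as the increment of \<open>b div p\<close> at position \<open>Suc s\<close>. The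
  last conjunct preserves the digit reset at \<open>s\<close> during that continuation.\<close>

lemma skip_inactive_carry:
  assumes "2 \<le> p" "digits p s b a"
  shows "\<exists>a' s'. skip_inactive p (r, a(s := a s + 1), s) =
           (r + carry_sum p (Suc b) - carry_sum p b, a', s') \<and>
           digits p s (Suc b) a' \<and> (\<forall>i<s. a' i = a i)"
  using assms(2)
proof (induction b arbitrary: r a s rule: less_induct)
  case (less b)
  have as: "a s = b mod p"
    using less.prems unfolding digits_def by (metis add_0_right div_by_1 power_0)
  define c where "c = b div p"
  have b: "b = p * c + b mod p" by (simp add: c_def)
  show ?case
  proof (cases "Suc (b mod p) = p")
    case False
    then have lt: "Suc (b mod p) < p"
      using assms(1) mod_less_divisor[of p b] by linarith
    then have d: "Suc b div p = c" "Suc b mod p = Suc (b mod p)"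
      by (auto simp: c_def div_Suc mod_Suc)
    have "carry_sum p (Suc b) = c + carry_sum p c"
      using carry_sum_digit[OF assms(1) lt, of c] b by simp
    moreover have "carry_sum p b = c + carry_sum p c"
      using carry_sum_digit[OF assms(1), of "b mod p" c] b assms(1) by simp
    moreover have "skip_inactive p (r, a(s := a s + 1), s) = (r, a(s := a s + 1), s)"
      unfolding skip_inactive_def using False as by (subst while_unfold) simp
    ultimately have "skip_inactive p (r, a(s := a s + 1), s)
        = (r + carry_sum p (Suc b) - carry_sum p b, a(s := a s + 1), s)"
      by simp
    moreover have "digits p s (Suc b) (a(s := a s + 1))"
      unfolding digits_def
    proof
      fix i
      show "(a(s := a s + 1)) (s + i) = Suc b div p ^ i mod p"
      proof (cases i)
        case 0
        then show ?thesis using as d by simp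
      next
        case (Suc j)
        have "a (s + i) = b div p ^ i mod p" using less.prems by (simp add: digits_def)
        also have "\<dots> = Suc b div p ^ i mod p"
          using d by (simp add: Suc div_mult2_eq c_def)
        finally show ?thesis using Suc by simp
      qed
    qed
    ultimately show ?thesis by fastforce
  next
    case True
    have "c < b" using True assms(1) b unfolding c_def
      by (metis One_nat_def Suc_1 Suc_le_eq div_less_dividend gr0I mod_0 not_less_eq_eq le_refl)
    have Sb: "Suc b = p * Suc c + 0" using b True by simp
    have cs1: "carry_sum p (Suc b) = Suc c + carry_sum p (Suc c)"
      using carry_sum_digit[OF assms(1), of 0 "Suc c"] Sb assms(1) by simp
    have cs2: "carry_sum p b = c + carry_sum p c"
      using carry_sum_digit[OF assms(1), of "b mod p" c] b assms(1) by simp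
    \<comment> \<open>The array after the reset; from \<open>Suc s\<close> on it still represents
      \<open>c\<close>, so the induction hypothesis applies.\<close>
    define a2 where "a2 = a(s := 0)"
    have dig2: "digits p (Suc s) c a2"
      unfolding digits_def
    proof
      fix i
      have "a (s + Suc i) = b div p ^ Suc i mod p" using less.prems unfolding digits_def by blast
      then show "a2 (Suc s + i) = c div p ^ i mod p"
        by (simp add: a2_def c_def div_mult2_eq)
    qed
    have "skip_inactive p (r, a(s := a s + 1), s)
        = skip_inactive p (r + 1, a2(Suc s := a2 (Suc s) + 1), Suc s)"
      unfolding skip_inactive_def using True as
      by (subst while_unfold) (simp add: a2_def)
    moreover obtain a' s' where a': "skip_inactive p (r + 1, a2(Suc s := a2 (Suc s) + 1), Suc s) =
           (r + 1 + carry_sum p (Suc c) - carry_sum p c, a', s')"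
           "digits p (Suc s) (Suc c) a'" "\<forall>i<Suc s. a' i = a2 i"
      using less.IH[OF \<open>c < b\<close> dig2, of "r + 1"] by blast
    moreover have "digits p s (Suc b) a'"
      unfolding digits_def
    proof
      fix i
      show "a' (s + i) = Suc b div p ^ i mod p"
      proof (cases i)
        case 0
        then show ?thesis using a'(3) Sb by (simp add: a2_def)
      next
        case (Suc j)
        then show ?thesis using a'(2) assms(1) unfolding Sb digits_def
          by (simp add: div_mult2_eq)
      qed
    qed
    moreover have "\<forall>i<s. a' i = a i" using a'(3) by (simp add: a2_def)
    moreover have "r + 1 + carry_sum p (Suc c) - carry_sum p c
        = r + carry_sum p (Suc b) - carry_sum p b"
      using cs1 cs2 by simp
    ultimately show ?thesis by metis
  qed
qed

definition update_blocks :: "nat \<Rightarrow> nat \<Rightarrow> nat list \<Rightarrow> counted_rows \<Rightarrow> counted_rows" where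
  "update_blocks p l = fold (\<lambda>b. update_block p (\<theta> p (l - 1)) (block_start p l b)
     (block_start p l b + \<theta> p l))"

text \<open>Induction on the number of blocks left. \<open>skip_inactive_carry\<close> yields the
  next start, and \<open>block_start_total\<close> makes the loop guard fail exactly at
  \<open>b = p ^ (k - l)\<close>.\<close>

lemma block_loop:
  assumes "2 \<le> p" "1 \<le> l" "l \<le> k" "digits p l b a" "b \<le> p ^ (k - l)"
  shows "fst (while (\<lambda>(Hc, r, a). r < \<theta> p k) (block_body p l) (Hc, block_start p l b, a))
       = update_blocks p l [b..<p ^ (k - l)] Hc"
  using assms(4,5)
proof (induction "p ^ (k - l) - b" arbitrary: b a Hc)
  case 0
  then have "b = p ^ (k - l)" by simp
  then show ?case using assms(1,3)
    by (subst while_unfold) (simp add: block_start_total update_blocks_def)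
next
  case (Suc n)
  then have b: "b < p ^ (k - l)" by simp
  have "block_start p l b < \<theta> p k"
    using block_start_less[OF b, of p l] theta_pos[OF assms(1,2)] assms(1,3)
    by (simp add: block_start_total)
  moreover obtain a' s' where a': "skip_inactive p (block_start p l b + \<theta> p l, a(l := a l + 1), l) =
     (block_start p l b + \<theta> p l + carry_sum p (Suc b) - carry_sum p b, a', s')"
     "digits p l (Suc b) a'"
    using skip_inactive_carry[OF assms(1) Suc.prems(1)] by blast
  moreover have "block_start p l b + \<theta> p l + carry_sum p (Suc b) - carry_sum p b
      = block_start p l (Suc b)"
    by (simp add: block_start_def)
  ultimately show ?case
    using b Suc.hyps(1)[of "Suc b" a'] Suc.hyps(2)
    by (subst while_unfold)
      (simp add: block_body_def update_blocks_def upt_conv_Cons)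
qed

lemma step_eq_update_blocks:
  assumes "2 \<le> p" "1 \<le> l" "l \<le> k"
  shows "step p k l Hc = update_blocks p l [0..<p ^ (k - l)] Hc"
  using block_loop[OF assms, of 0 "\<lambda>_. 0" Hc] by (simp add: step_def digits_def)

section \<open>The recursion for \<open>G\<close>, \<open>M\<close> and the rows of the target
  matrix\<close>

lemma dim_G [simp]:
  assumes "1 \<le> l" "2 \<le> p"
  shows "dim_row (G p l) = l" "dim_col (G p l) = \<theta> p l"
  using assms by (cases "(p, l)" rule: G.cases; simp add: theta_1 Let_def)+

lemma index_M:
  assumes "2 \<le> p" "1 \<le> l" "i < \<theta> p l" "j < \<theta> p l"
  shows "M p l $$ (i, j) = (\<Sum>h<l. G p l $$ (h, i) * G p l $$ (h, j)) mod p"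
  using assms by (simp add: M_def scalar_prod_def atLeast0LessThan)

lemma index_M_less:
  assumes "2 \<le> p" "1 \<le> l" "i < \<theta> p l" "j < \<theta> p l"
  shows "M p l $$ (i, j) < p"
  using assms by (simp add: index_M)

lemma M_1:
  assumes "2 \<le> p"
  shows "M p (Suc 0) $$ (0, 0) = 1"
  using assms by (simp add: index_M theta_1)

lemma block_index_less:
  fixes t :: nat
  assumes "v < p" "j < t"
  shows "v * t + j < p * t"
proof -
  have "v * t + j < Suc v * t" using assms by simp
  also have "\<dots> \<le> p * t" using assms by (intro mult_le_mono1) simp
  finally show ?thesis .
qed

lemma index_G_Suc:
  assumes "1 \<le> l" "i < Suc l" "j < \<theta> p (Suc l)"
  shows "G p (Suc l) $$ (i, j) =
    (if i = 0 then (if j < p * \<theta> p l then j div \<theta> p l else 1)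
     else (if j < p * \<theta> p l then G p l $$ (i - 1, j mod \<theta> p l) else 0))"
  using assms by (cases l) (simp_all add: Let_def)

lemma index_G_block:
  assumes "2 \<le> p" "1 \<le> l" "v < p" "j < \<theta> p l"
  shows "G p (Suc l) $$ (0, v * \<theta> p l + j) = v"
    and "h < l \<Longrightarrow> G p (Suc l) $$ (Suc h, v * \<theta> p l + j) = G p l $$ (h, j)"
proof -
  have less: "v * \<theta> p l + j < p * \<theta> p l" by (rule block_index_less[OF assms(3,4)])
  then have "v * \<theta> p l + j < \<theta> p (Suc l)" unfolding theta_Suc[OF assms(1)] by simp
  then show "G p (Suc l) $$ (0, v * \<theta> p l + j) = v"
    and "h < l \<Longrightarrow> G p (Suc l) $$ (Suc h, v * \<theta> p l + j) = G p l $$ (h, j)"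
    using assms less by (simp_all add: index_G_Suc)
qed

lemma index_G_last:
  assumes "2 \<le> p" "1 \<le> l"
  shows "G p (Suc l) $$ (0, p * \<theta> p l) = 1"
    and "h < l \<Longrightarrow> G p (Suc l) $$ (Suc h, p * \<theta> p l) = 0"
proof -
  have "p * \<theta> p l < \<theta> p (Suc l)" unfolding theta_Suc[OF assms(1)] by simp
  then show "G p (Suc l) $$ (0, p * \<theta> p l) = 1"
    and "h < l \<Longrightarrow> G p (Suc l) $$ (Suc h, p * \<theta> p l) = 0"
    using assms by (simp_all add: index_G_Suc)
qed

text \<open>The top row is split off the inner product of two columns because the recursion for
  \<open>G\<close> treats it separately.\<close>

lemma index_M_Suc_rows:
  assumes "2 \<le> p" "1 \<le> l" "x < \<theta> p (Suc l)" "y < \<theta> p (Suc l)"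
  shows "M p (Suc l) $$ (x, y) = (G p (Suc l) $$ (0, x) * G p (Suc l) $$ (0, y)
    + (\<Sum>h<l. G p (Suc l) $$ (Suc h, x) * G p (Suc l) $$ (Suc h, y))) mod p"
  using assms by (simp add: index_M sum.lessThan_Suc_shift del: sum.lessThan_Suc)

text \<open>A column of the larger \<open>G\<close> is either \<open>u\<close> on top of column
  \<open>i\<close> of the smaller one, or the first unit vector; the four cases are the inner
  products of these. In the last three the value is already below \<open>p\<close>.\<close>

lemma index_M_Suc:
  assumes "2 \<le> p" "1 \<le> l"
  shows "u < p \<Longrightarrow> i < \<theta> p l \<Longrightarrow> v < p \<Longrightarrow> j < \<theta> p l \<Longrightarrow>
      M p (Suc l) $$ (u * \<theta> p l + i, v * \<theta> p l + j) = (u * v + M p l $$ (i, j)) mod p"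
    and "u < p \<Longrightarrow> i < \<theta> p l \<Longrightarrow> M p (Suc l) $$ (u * \<theta> p l + i, p * \<theta> p l) = u"
    and "v < p \<Longrightarrow> j < \<theta> p l \<Longrightarrow> M p (Suc l) $$ (p * \<theta> p l, v * \<theta> p l + j) = v"
    and "M p (Suc l) $$ (p * \<theta> p l, p * \<theta> p l) = 1"
proof -
  have le: "c * \<theta> p l + d < \<theta> p (Suc l)" if "c < p" "d < \<theta> p l" for c d
    using block_index_less[OF that] assms(1) by (simp add: theta_Suc)
  have last: "p * \<theta> p l < \<theta> p (Suc l)" using assms(1) by (simp add: theta_Suc)
  show "M p (Suc l) $$ (u * \<theta> p l + i, v * \<theta> p l + j) = (u * v + M p l $$ (i, j)) mod p"
    if "u < p" "i < \<theta> p l" "v < p" "j < \<theta> p l"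
    using that assms by (simp add: index_M_Suc_rows le index_G_block index_M[OF assms] mod_add_right_eq)
  show "M p (Suc l) $$ (u * \<theta> p l + i, p * \<theta> p l) = u" if "u < p" "i < \<theta> p l"
    using that assms by (simp add: index_M_Suc_rows le last index_G_block index_G_last)
  show "M p (Suc l) $$ (p * \<theta> p l, v * \<theta> p l + j) = v" if "v < p" "j < \<theta> p l"
    using that assms by (simp add: index_M_Suc_rows le last index_G_block index_G_last)
  show "M p (Suc l) $$ (p * \<theta> p l, p * \<theta> p l) = 1"
    using assms by (simp add: index_M_Suc_rows last index_G_last)
qed

text \<open>The rows of \<open>M_char\<close>, with a function in place of the vector: restricting \<open>\<chi>\<close> to a block of
  rows is then merely a shift of the argument of \<open>f\<close>.\<close>

definition char_row :: "nat \<Rightarrow> nat \<Rightarrow> (nat \<Rightarrow> int) \<Rightarrow> nat \<Rightarrow> nat \<Rightarrow> int" where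
  "char_row p l f i u = (\<Sum>j<\<theta> p l. if M p l $$ (i, j) = u then f j else 0)"

text \<open>Every \<open>j\<close> is counted for exactly one \<open>u\<close>. The sum does not
  depend on \<open>i\<close>, which is why LastRow may read just the first row of each
  sub-block.\<close>

lemma sum_char_row:
  assumes "2 \<le> p" "1 \<le> l" "i < \<theta> p l"
  shows "(\<Sum>u<p. char_row p l f i u) = (\<Sum>j<\<theta> p l. f j)"
proof -
  have "(\<Sum>u<p. char_row p l f i u)
      = (\<Sum>j<\<theta> p l. \<Sum>u<p. if M p l $$ (i, j) = u then f j else 0)"
    unfolding char_row_def by (rule sum.swap)
  also have "\<dots> = (\<Sum>j<\<theta> p l. f j)"
    using assms by (intro sum.cong) (simp_all add: index_M_less)
  finally show ?thesis .
qed

lemma sum_lessThan_mult: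
  fixes f :: "nat \<Rightarrow> 'a :: comm_monoid_add"
  shows "(\<Sum>x<p * t. f x) = (\<Sum>v<p. \<Sum>j<t. f (v * t + j))"
proof (induction p)
  case 0
  show ?case by simp
next
  case (Suc p)
  have "(\<Sum>x<Suc p * t. f x) = (\<Sum>x<p * t + t. f x)" by (simp add: add.commute)
  also have "\<dots> = (\<Sum>x<p * t. f x) + (\<Sum>j<t. f (p * t + j))"
    using sum.atLeastLessThan_concat[of 0 "p * t" "p * t + t" f]
      sum.shift_bounds_nat_ivl[of f 0 "p * t" t]
    by (simp add: atLeast0LessThan add.commute)
  finally show ?case using Suc by simp
qed

lemma char_row_Suc:
  assumes "2 \<le> p" "1 \<le> l"
  shows "char_row p (Suc l) f x w =
      (\<Sum>v<p. \<Sum>j<\<theta> p l. if M p (Suc l) $$ (x, v * \<theta> p l + j) = w then f (v * \<theta> p l + j) else 0)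
      + (if M p (Suc l) $$ (x, p * \<theta> p l) = w then f (p * \<theta> p l) else 0)"
  using assms by (simp add: char_row_def theta_Suc sum_lessThan_mult)

text \<open>Solves for \<open>m\<close>, with subtraction of \<open>c\<close> modulo
  \<open>p\<close> expressed as addition of \<open>c * (p - 1)\<close>; repeated right shifts
  produce an index of this form in \<open>rcs_funpow\<close>.\<close>

lemma mod_add_eq_iff:
  fixes p :: nat
  assumes "m < p" "w < p"
  shows "(c + m) mod p = w \<longleftrightarrow> m = (w + c * (p - 1)) mod p"
proof -
  have "(c + (w + c * (p - 1))) mod p = w"
  proof -
    have "c + (w + c * (p - 1)) = w + p * c" using assms by (cases p) auto
    then show ?thesis using assms by (simp only: mod_mult_self2 mod_less)
  qed
  moreover have "((c + m) + c * (p - 1)) mod p = m"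
  proof -
    have "(c + m) + c * (p - 1) = m + p * c" using assms by (cases p) auto
    then show ?thesis using assms by (simp only: mod_mult_self2 mod_less)
  qed
  ultimately show ?thesis by (metis mod_add_left_eq mod_add_right_eq)
qed

text \<open>The condition \<open>u * v + m = w\<close> modulo \<open>p\<close> is solved for
  \<open>m\<close>, so sub-block \<open>v\<close> contributes its row \<open>i\<close> shifted by
  \<open>u * v\<close>, as in AllRows. The extra term is the last column.\<close>

lemma char_row_block:
  assumes "2 \<le> p" "1 \<le> l" "u < p" "i < \<theta> p l" "w < p"
  shows "char_row p (Suc l) f (u * \<theta> p l + i) w =
      (\<Sum>v<p. char_row p l (\<lambda>j. f (v * \<theta> p l + j)) i ((w + u * v * (p - 1)) mod p))
      + (if u = w then f (p * \<theta> p l) else 0)"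
proof -
  have "(\<Sum>j<\<theta> p l. if M p (Suc l) $$ (u * \<theta> p l + i, v * \<theta> p l + j) = w
           then f (v * \<theta> p l + j) else 0)
      = char_row p l (\<lambda>j. f (v * \<theta> p l + j)) i ((w + u * v * (p - 1)) mod p)" if "v < p" for v
    unfolding char_row_def
    using assms that by (intro sum.cong) (simp_all add: index_M_Suc index_M_less mod_add_eq_iff)
  then show ?thesis using assms by (simp add: char_row_Suc index_M_Suc)
qed

text \<open>All columns of sub-block \<open>v\<close> have the same product \<open>v\<close> with
  the last column of \<open>G\<close>, so entry \<open>w\<close> collects the whole of sub-block
  \<open>w\<close>.\<close>

lemma char_row_last:
  assumes "2 \<le> p" "1 \<le> l" "w < p"
  shows "char_row p (Suc l) f (p * \<theta> p l) w =
      (\<Sum>j<\<theta> p l. f (w * \<theta> p l + j)) + (if w = 1 then f (p * \<theta> p l) else 0)"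
proof -
  have "(\<Sum>v<p. \<Sum>j<\<theta> p l. if M p (Suc l) $$ (p * \<theta> p l, v * \<theta> p l + j) = w
           then f (v * \<theta> p l + j) else 0)
      = (\<Sum>v<p. if w = v then (\<Sum>j<\<theta> p l. f (v * \<theta> p l + j)) else 0)"
    using assms by (intro sum.cong) (auto simp: index_M_Suc)
  then show ?thesis using assms by (simp add: char_row_Suc index_M_Suc)
qed

lemma M_char_eq:
  "M_char p k \<chi> = mat (\<theta> p k) p (\<lambda>(i, u). char_row p k (vec_index \<chi>) i u)"
proof -
  have "{j. j < \<theta> p k \<and> P j} = {j \<in> {..<\<theta> p k}. P j}" for P by auto
  then show ?thesis
    unfolding M_char_def char_row_def
    by (simp only: sum.inter_filter[OF finite_lessThan])
qed

section \<open>Effect and cost of Add0, LastRow and AllRows\<close>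

lemma rcs_funpow:
  assumes "u < p"
  shows "(rcs p ^^ n) v u = v ((u + n * (p - 1)) mod p)"
  using assms
proof (induction n arbitrary: u)
  case 0
  then show ?case by simp
next
  case (Suc n)
  have "(rcs p ^^ Suc n) v u = (rcs p ^^ n) v ((u + p - 1) mod p)"
    by (simp add: rcs_def)
  also have "\<dots> = v (((u + p - 1) mod p + n * (p - 1)) mod p)"
    using Suc by simp
  also have "((u + p - 1) mod p + n * (p - 1)) mod p = (u + Suc n * (p - 1)) mod p"
    using Suc.prems by (simp add: mod_add_left_eq add.assoc)
  finally show ?case .
qed

text \<open>The hypothesis places row \<open>r\<close> after all rows that are changed, so the
  summand \<open>lcs p (H r)\<close> stays the same throughout the fold.\<close>

lemma add0_spec:
  assumes "r0 + 2 * t < r"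
  shows "add0 p t r0 r (H, c) =
    ((\<lambda>x. if r0 + t < x \<and> x \<le> r0 + 2 * t then (\<lambda>u. H x u + lcs p (H r) u) else H x), c + t)"
proof -
  have "fold (add0_row p t r0 r) [1..<n + 1] (H, c) =
    ((\<lambda>x. if r0 + t < x \<and> x \<le> r0 + t + n then (\<lambda>u. H x u + lcs p (H r) u) else H x), c + n)"
    if "n \<le> t" for n
    using that
  proof (induction n)
    case 0
    then show ?case by (auto simp: fun_eq_iff)
  next
    case (Suc n)
    then show ?case using assms by (auto simp: add0_row_def fun_eq_iff)
  qed
  from this[of t] show ?thesis by (simp add: add0_def mult_2 add.assoc)
qed

lemma last_row_spec:
  "last_row p t r0 r (H, c) = (H(r := (\<lambda>j. \<Sum>i<p. H (r0 + j * t + 1) i)), c + p * p)"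
proof -
  have "sum_list (last_row_summands p t r0 H j) = (\<Sum>i<p. H (r0 + j * t + 1) i)" for j
    unfolding last_row_summands_def interv_sum_list_conv_sum_set_nat set_upt atLeast0LessThan ..
  moreover have "length (last_row_summands p t r0 H j) = p" for j
    unfolding last_row_summands_def by simp
  ultimately show ?thesis unfolding last_row_def by simp
qed

text \<open>With \<open>0 < t\<close> the \<open>p\<close> target rows are distinct, so no put
  overwrites an earlier one; the saved rows keep all summands at their old values.\<close>

lemma all_rows_at_spec:
  assumes "0 < t"
  shows "\<exists>H'. all_rows_at p t r0 i (H, c) = (H', c + p * p * p) \<and>
    (\<forall>j<p. H' (r0 + j * t + i) = (\<lambda>u. \<Sum>q<p. (rcs p ^^ (j * q)) (H (r0 + q * t + i)) u)) \<and>
    (\<forall>x. (\<forall>j<p. x \<noteq> r0 + j * t + i) \<longrightarrow> H' x = H x)"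
proof -
  define T where "T = (\<lambda>j. H (r0 + j * t + i))"
  have "\<exists>H'. fold (all_rows_put p t r0 i T) [0..<n] (H, c) = (H', c + n * (p * p)) \<and>
    (\<forall>j<n. H' (r0 + j * t + i) = (\<lambda>u. \<Sum>q<p. (rcs p ^^ (j * q)) (T q) u)) \<and>
    (\<forall>x. (\<forall>j<n. x \<noteq> r0 + j * t + i) \<longrightarrow> H' x = H x)" for n
  proof (induction n)
    case 0
    show ?case by simp
  next
    case (Suc n)
    then obtain H' where H': "fold (all_rows_put p t r0 i T) [0..<n] (H, c) = (H', c + n * (p * p))"
      "\<forall>j<n. H' (r0 + j * t + i) = (\<lambda>u. \<Sum>q<p. (rcs p ^^ (j * q)) (T q) u)"
      "\<forall>x. (\<forall>j<n. x \<noteq> r0 + j * t + i) \<longrightarrow> H' x = H x"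
      by blast
    let ?H = "H'(r0 + n * t + i := (\<lambda>u. \<Sum>q<p. (rcs p ^^ (n * q)) (T q) u))"
    have "all_rows_put p t r0 i T n (H', c + n * (p * p)) = (?H, c + Suc n * (p * p))"
      by (simp add: all_rows_put_def all_rows_summands_def interv_sum_list_conv_sum_set_nat
          atLeast0LessThan)
    then have "fold (all_rows_put p t r0 i T) [0..<Suc n] (H, c) = (?H, c + Suc n * (p * p))"
      using H'(1) by simp
    moreover have "\<forall>j<Suc n. ?H (r0 + j * t + i) = (\<lambda>u. \<Sum>q<p. (rcs p ^^ (j * q)) (T q) u)"
      using H'(2) assms by (auto simp: less_Suc_eq)
    moreover have "\<forall>x. (\<forall>j<Suc n. x \<noteq> r0 + j * t + i) \<longrightarrow> ?H x = H x"
      using H'(3) by auto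
    ultimately show ?case by blast
  qed
  from this[of p] show ?thesis
    by (simp add: all_rows_at_def Let_def T_def mult.assoc)
qed

text \<open>Rounds for different \<open>i\<close> act on different residue classes modulo
  \<open>t\<close>, so each reads rows that no earlier round has changed. Here \<open>i\<close>
  counts from 0, whence the \<open>+ 1\<close>.\<close>

lemma all_rows_spec:
  assumes "0 < t"
  shows "\<exists>H'. all_rows p t r0 (H, c) = (H', c + t * (p * p * p)) \<and>
    (\<forall>i<t. \<forall>j<p. H' (r0 + j * t + i + 1) =
        (\<lambda>u. \<Sum>q<p. (rcs p ^^ (j * q)) (H (r0 + q * t + i + 1)) u)) \<and>
    (\<forall>x. x \<le> r0 \<or> r0 + p * t < x \<longrightarrow> H' x = H x)"
proof -
  have "\<exists>H'. fold (all_rows_at p t r0) [1..<n + 1] (H, c) = (H', c + n * (p * p * p)) \<and>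
    (\<forall>i<n. \<forall>j<p. H' (r0 + j * t + i + 1) =
        (\<lambda>u. \<Sum>q<p. (rcs p ^^ (j * q)) (H (r0 + q * t + i + 1)) u)) \<and>
    (\<forall>x. (\<forall>i<n. \<forall>j<p. x \<noteq> r0 + j * t + i + 1) \<longrightarrow> H' x = H x)" if "n \<le> t" for n
    using that
  proof (induction n)
    case 0
    show ?case by simp
  next
    case (Suc n)
    then obtain H' where
      H': "fold (all_rows_at p t r0) [1..<n + 1] (H, c) = (H', c + n * (p * p * p))"
      "\<And>i j. i < n \<Longrightarrow> j < p \<Longrightarrow> H' (r0 + j * t + i + 1) =
        (\<lambda>u. \<Sum>q<p. (rcs p ^^ (j * q)) (H (r0 + q * t + i + 1)) u)"
      "\<And>x. \<forall>i<n. \<forall>j<p. x \<noteq> r0 + j * t + i + 1 \<Longrightarrow> H' x = H x"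
      by auto
    obtain H'' where
      H'': "all_rows_at p t r0 (n + 1) (H', c + n * (p * p * p))
          = (H'', c + n * (p * p * p) + p * p * p)"
      "\<And>j. j < p \<Longrightarrow> H'' (r0 + j * t + (n + 1))
          = (\<lambda>u. \<Sum>q<p. (rcs p ^^ (j * q)) (H' (r0 + q * t + (n + 1))) u)"
      "\<And>x. \<forall>j<p. x \<noteq> r0 + j * t + (n + 1) \<Longrightarrow> H'' x = H' x"
      using all_rows_at_spec[OF assms, of p r0 "n + 1" H' "c + n * (p * p * p)"] by blast
    have inj: "r0 + j * t + i + 1 \<noteq> r0 + j' * t + (n + 1)" if "i < n" for i j j'
    proof
      assume "r0 + j * t + i + 1 = r0 + j' * t + (n + 1)"
      then have "(j * t + i) mod t = (j' * t + n) mod t" by simp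
      then show False using that Suc.prems by simp
    qed
    have "fold (all_rows_at p t r0) [1..<Suc n + 1] (H, c) = (H'', c + Suc n * (p * p * p))"
      using H'(1) H''(1) by (simp add: add.assoc)
    moreover have "H'' (r0 + j * t + i + 1) =
        (\<lambda>u. \<Sum>q<p. (rcs p ^^ (j * q)) (H (r0 + q * t + i + 1)) u)" if "i < Suc n" "j < p" for i j
    proof (cases "i = n")
      case False
      with that(1) have "i < n" by simp
      have "H'' (r0 + j * t + i + 1) = H' (r0 + j * t + i + 1)"
        by (rule H''(3)) (intro allI impI inj \<open>i < n\<close>)
      then show ?thesis using H'(2)[OF \<open>i < n\<close> that(2)] by simp
    next
      case True
      have "H' (r0 + q * t + (n + 1)) = H (r0 + q * t + (n + 1))" for q
        by (rule H'(3)) (intro allI impI inj[THEN not_sym])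
      then show ?thesis using H''(2)[OF that(2)] True by (simp add: add.assoc)
    qed
    moreover have "H'' x = H x" if "\<forall>i<Suc n. \<forall>j<p. x \<noteq> r0 + j * t + i + 1" for x
    proof -
      have "H'' x = H' x" using that by (intro H''(3)) auto
      also have "\<dots> = H x" using that by (intro H'(3)) auto
      finally show ?thesis .
    qed
    ultimately show ?case by blast
  qed
  from this[of t] obtain H' where
    H': "fold (all_rows_at p t r0) [1..<t + 1] (H, c) = (H', c + t * (p * p * p))"
      "\<forall>i<t. \<forall>j<p. H' (r0 + j * t + i + 1) =
        (\<lambda>u. \<Sum>q<p. (rcs p ^^ (j * q)) (H (r0 + q * t + i + 1)) u)"
      "\<And>x. \<forall>i<t. \<forall>j<p. x \<noteq> r0 + j * t + i + 1 \<Longrightarrow> H' x = H x"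
    by auto
  have "H' x = H x" if "x \<le> r0 \<or> r0 + p * t < x" for x
  proof (rule H'(3), intro allI impI)
    fix i j
    assume "i < t" "j < p"
    then show "x \<noteq> r0 + j * t + i + 1" using that block_index_less[of j p i t] by linarith
  qed
  with H' show ?thesis unfolding all_rows_def by blast
qed

section \<open>Correctness of the update of one block\<close>

text \<open>Rows count from 1 and arguments of \<open>f\<close> from 0, so row
  \<open>r0 + i + 1\<close> belongs to \<open>f (r0 + i)\<close>.\<close>

definition block_done :: "nat \<Rightarrow> nat \<Rightarrow> (nat \<Rightarrow> int) \<Rightarrow> nat \<Rightarrow> rows \<Rightarrow> bool" where
  "block_done p l f r0 H \<longleftrightarrow>
    (\<forall>i<\<theta> p l. \<forall>u<p. H (r0 + i + 1) u = char_row p l (\<lambda>j. f (r0 + j)) i u)"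

text \<open>Add0 carries the value of the last column into entry 0 of sub-block 1; then AllRows
  produces the right-hand side of \<open>char_row_block\<close>, and LastRow that of
  \<open>char_row_last\<close>.\<close>

lemma update_block_spec:
  assumes "2 \<le> p" "1 \<le> l"
  shows "\<exists>H'. update_block p (\<theta> p l) r0 (r0 + \<theta> p (Suc l)) (H, c)
      = (H', c + (p\<^sup>2 * \<theta> p (Suc l) + \<theta> p l)) \<and>
    (\<forall>x. x \<le> r0 \<or> r0 + \<theta> p (Suc l) < x \<longrightarrow> H' x = H x) \<and>
    ((\<forall>j<p. block_done p l f (r0 + j * \<theta> p l) H) \<longrightarrow>
     (\<forall>u. H (r0 + \<theta> p (Suc l)) u = (if u = 1 then f (r0 + p * \<theta> p l) else 0)) \<longrightarrow>
     block_done p (Suc l) f r0 H')"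
proof -
  define t where "t = \<theta> p l"
  define r where "r = r0 + \<theta> p (Suc l)"
  have t: "0 < t" using theta_pos[OF assms] by (simp add: t_def)
  have r: "r = r0 + p * t + 1" using assms by (simp add: r_def t_def theta_Suc)
  have "2 * t \<le> p * t" using assms by simp
  then have r2: "r0 + 2 * t < r" using r by linarith
  define H1 where "H1 = (\<lambda>x. if r0 + t < x \<and> x \<le> r0 + 2 * t
    then (\<lambda>u. H x u + lcs p (H r) u) else H x)"
  define H2 where "H2 = H1(r := (\<lambda>j. \<Sum>i<p. H1 (r0 + j * t + 1) i))"
  obtain H' where H': "all_rows p t r0 (H2, c + t + p * p) = (H', c + t + p * p + t * (p * p * p))"
    "\<And>i j. i < t \<Longrightarrow> j < p \<Longrightarrow> H' (r0 + j * t + i + 1) =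
        (\<lambda>u. \<Sum>q<p. (rcs p ^^ (j * q)) (H2 (r0 + q * t + i + 1)) u)"
    "\<And>x. x \<le> r0 \<or> r0 + p * t < x \<Longrightarrow> H' x = H2 x"
    using all_rows_spec[OF t, of p r0 H2 "c + t + p * p"] by blast
  \<comment> \<open>\<open>t\<close> for Add0, \<open>p * p\<close> for LastRow and \<open>t\<close>
    rounds of \<open>p * p * p\<close> for AllRows; the last two combine because
    \<open>p * t + 1\<close> is \<open>\<theta> p (Suc l)\<close>.\<close>
  have count: "c + t + p * p + t * (p * p * p) = c + (p\<^sup>2 * \<theta> p (Suc l) + \<theta> p l)"
    using assms by (simp add: theta_Suc t_def power2_eq_square algebra_simps)
  have upd: "update_block p t r0 r (H, c) = (H', c + (p\<^sup>2 * \<theta> p (Suc l) + \<theta> p l))"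
    unfolding update_block_def add0_spec[OF r2] last_row_spec H1_def[symmetric] H2_def[symmetric]
      H'(1) count ..
  have outside: "H' x = H x" if "x \<le> r0 \<or> r < x" for x
  proof -
    have "H' x = H2 x" using that r by (intro H'(3)) linarith
    also have "\<dots> = H1 x" using that r by (auto simp: H2_def)
    also have "\<dots> = H x" using that r2 by (auto simp: H1_def)
    finally show ?thesis .
  qed
  have "block_done p (Suc l) f r0 H'"
    if prev: "\<And>j. j < p \<Longrightarrow> block_done p l f (r0 + j * t) H"
      and last: "\<And>u. H r u = (if u = 1 then f (r0 + p * t) else 0)"
  proof -
    have H1: "H1 (r0 + q * t + i + 1) u = char_row p l (\<lambda>j. f (r0 + (q * t + j))) i u
        + (if q = 1 \<and> u = 0 then f (r0 + p * t) else 0)"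
      if "q < p" "i < t" "u < p" for q i u
    proof -
      have "H (r0 + q * t + i + 1) u = char_row p l (\<lambda>j. f (r0 + (q * t + j))) i u"
        using prev[OF that(1)] that(2,3) by (simp add: block_done_def t_def add.assoc)
      moreover have first: "(r0 + t < r0 + q * t + i + 1 \<and> r0 + q * t + i + 1 \<le> r0 + 2 * t) \<longleftrightarrow> q = 1"
      proof -
        consider "q = 0" | "q = 1" | "2 \<le> q" by linarith
        then show ?thesis
        proof cases
          case 3
          then have "2 * t \<le> q * t" by simp
          then have "r0 + 2 * t < r0 + q * t + i + 1" by linarith
          with 3 show ?thesis by linarith
        qed (use that(2) in auto)
      qed
      \<comment> \<open>For \<open>Suc u = p\<close> the index wraps around to entry 0 of
        \<open>H r\<close>, which vanishes, while \<open>u\<close> itself is not 0 as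
        \<open>2 \<le> p\<close>.\<close>
      moreover have "lcs p (H r) u = (if u = 0 then f (r0 + p * t) else 0)"
        using that(3) assms(1) last by (cases "Suc u = p") (auto simp: lcs_def)
      ultimately show ?thesis unfolding H1_def first by (cases "q = 1") simp_all
    qed
    have H2: "H2 (r0 + q * t + i + 1) = H1 (r0 + q * t + i + 1)" if "q < p" "i < t" for q i
    proof -
      have "r0 + q * t + i + 1 \<noteq> r" using block_index_less[OF that] r by linarith
      then show ?thesis unfolding H2_def by (rule fun_upd_other)
    qed
    have block: "H' (r0 + (j * t + i) + 1) u = char_row p (Suc l) (\<lambda>j. f (r0 + j)) (j * t + i) u"
      if "j < p" "i < t" "u < p" for i j u
    proof -
      have m: "(u + j * q * (p - 1)) mod p < p" for q using assms(1) by simp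
      have "H' (r0 + (j * t + i) + 1) u
          = (\<Sum>q<p. H1 (r0 + q * t + i + 1) ((u + j * q * (p - 1)) mod p))"
      proof -
        have "H' (r0 + (j * t + i) + 1) u
            = (\<Sum>q<p. (rcs p ^^ (j * q)) (H2 (r0 + q * t + i + 1)) u)"
          using H'(2)[OF that(2,1)] by (simp only: add.assoc)
        also have "\<dots> = (\<Sum>q<p. H1 (r0 + q * t + i + 1) ((u + j * q * (p - 1)) mod p))"
          using that(2,3) by (intro sum.cong refl) (simp only: lessThan_iff H2 rcs_funpow)
        finally show ?thesis .
      qed
      also have "\<dots> = (\<Sum>q<p. char_row p l (\<lambda>j. f (r0 + (q * t + j))) i ((u + j * q * (p - 1)) mod p)
          + (if q = 1 then if (u + j * q * (p - 1)) mod p = 0 then f (r0 + p * t) else 0 else 0))"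
        using m that(2) by (intro sum.cong refl) (simp only: lessThan_iff H1 if_if_eq_conj)
      also have "\<dots> = (\<Sum>q<p. char_row p l (\<lambda>j. f (r0 + (q * t + j))) i ((u + j * q * (p - 1)) mod p))
          + (if (u + j * 1 * (p - 1)) mod p = 0 then f (r0 + p * t) else 0)"
        using assms(1) unfolding sum.distrib by simp
      \<comment> \<open>After \<open>j\<close> right shifts the value that Add0 put at entry 0 sits
        at entry \<open>j\<close>, where \<open>char_row_block\<close> has the last column.\<close>
      also have "(u + j * 1 * (p - 1)) mod p = 0 \<longleftrightarrow> j = u"
        using mod_add_eq_iff[of 0 p u j] that assms(1) by auto
      finally show ?thesis
        using that assms by (simp add: char_row_block t_def add.assoc)
    qed
    have lastrow: "H' (r0 + p * t + 1) u = char_row p (Suc l) (\<lambda>j. f (r0 + j)) (p * t) u"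
      if "u < p" for u
    proof -
      \<comment> \<open>AllRows ends at row \<open>r0 + p * t\<close>, so row \<open>r\<close> keeps
        what LastRow put there: row sums that, for \<open>u = 1\<close>, already include the value
        added by Add0.\<close>
      have "H' (r0 + p * t + 1) u = (\<Sum>i<p. H1 (r0 + u * t + 0 + 1) i)"
        using H'(3)[of r] r by (simp add: H2_def)
      also have "\<dots> = (\<Sum>i<p. char_row p l (\<lambda>j. f (r0 + (u * t + j))) 0 i
          + (if i = 0 then if u = 1 then f (r0 + p * t) else 0 else 0))"
        using that t by (intro sum.cong refl) (subst H1, auto)
      also have "\<dots> = (\<Sum>j<t. f (r0 + (u * t + j))) + (if u = 1 then f (r0 + p * t) else 0)"
        using assms t unfolding sum.distrib by (simp add: sum_char_row t_def)
      finally show ?thesis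
        using that assms by (simp add: char_row_last t_def)
    qed
    show ?thesis
      unfolding block_done_def
    proof (intro allI impI)
      fix i u
      assume i: "i < \<theta> p (Suc l)" and u: "u < p"
      show "H' (r0 + i + 1) u = char_row p (Suc l) (\<lambda>j. f (r0 + j)) i u"
      proof (cases "i = p * t")
        case True
        then show ?thesis using lastrow[OF u] by simp
      next
        case False
        then have "i < p * t" using i assms(1) by (simp add: theta_Suc t_def)
        then have "i div t < p" by (simp add: less_mult_imp_div_less)
        then show ?thesis using block[of "i div t" "i mod t" u] t u by simp
      qed
    qed
  qed
  then show ?thesis using upd outside unfolding t_def r_def by blast
qed

section \<open>Correctness of one step\<close>

text \<open>The second clause keeps the initial values outside the current blocks; a later step
  reads them in the last rows of its larger blocks.\<close>

definition step_done :: "nat \<Rightarrow> nat \<Rightarrow> nat \<Rightarrow> (nat \<Rightarrow> int) \<Rightarrow> rows \<Rightarrow> bool" where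
  "step_done p k l f H \<longleftrightarrow>
    (\<forall>b<p ^ (k - l). block_done p l f (block_start p l b) H) \<and>
    (\<forall>x u. (\<forall>b<p ^ (k - l). x \<le> block_start p l b \<or> block_start p l b + \<theta> p l < x) \<longrightarrow>
      H x u = (if u = 1 then f (x - 1) else 0))"

text \<open>Blocks are processed in the order of their rows and do not overlap, so block
  \<open>n\<close> still finds its rows as the previous step left them.\<close>

lemma update_blocks_spec:
  assumes "2 \<le> p" "1 \<le> l" "Suc l \<le> k" "step_done p k l f H" "n \<le> p ^ (k - Suc l)"
  shows "\<exists>H'. update_blocks p (Suc l) [0..<n] (H, c)
      = (H', c + n * (p\<^sup>2 * \<theta> p (Suc l) + \<theta> p l)) \<and>
    (\<forall>b<n. block_done p (Suc l) f (block_start p (Suc l) b) H') \<and>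
    (\<forall>x. (\<forall>b<n. x \<le> block_start p (Suc l) b \<or> block_start p (Suc l) b + \<theta> p (Suc l) < x)
      \<longrightarrow> H' x = H x)"
  using assms(5)
proof (induction n)
  case 0
  show ?case by (simp add: update_blocks_def)
next
  case (Suc n)
  let ?R = "block_start p (Suc l)"
  obtain H1 where H1: "update_blocks p (Suc l) [0..<n] (H, c)
      = (H1, c + n * (p\<^sup>2 * \<theta> p (Suc l) + \<theta> p l))"
    "\<And>b. b < n \<Longrightarrow> block_done p (Suc l) f (?R b) H1"
    "\<And>x. (\<And>b. b < n \<Longrightarrow> x \<le> ?R b \<or> ?R b + \<theta> p (Suc l) < x) \<Longrightarrow> H1 x = H x"
    using Suc by auto
  obtain H2 where H2: "update_block p (\<theta> p l) (?R n) (?R n + \<theta> p (Suc l))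
        (H1, c + n * (p\<^sup>2 * \<theta> p (Suc l) + \<theta> p l))
      = (H2, c + n * (p\<^sup>2 * \<theta> p (Suc l) + \<theta> p l) + (p\<^sup>2 * \<theta> p (Suc l) + \<theta> p l))"
    "\<And>x. x \<le> ?R n \<or> ?R n + \<theta> p (Suc l) < x \<Longrightarrow> H2 x = H1 x"
    "(\<And>j. j < p \<Longrightarrow> block_done p l f (?R n + j * \<theta> p l) H1) \<Longrightarrow>
     (\<And>u. H1 (?R n + \<theta> p (Suc l)) u = (if u = 1 then f (?R n + p * \<theta> p l) else 0)) \<Longrightarrow>
     block_done p (Suc l) f (?R n) H2"
    using update_block_spec[OF assms(1,2), of "?R n" H1 _ f] by blast
  have same: "H1 x = H x" if "?R n < x" for x
  proof (rule H1(3))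
    fix b
    assume "b < n"
    then show "x \<le> ?R b \<or> ?R b + \<theta> p (Suc l) < x"
      using block_start_less[of b n p "Suc l"] that by simp
  qed
  have pow: "p ^ (k - l) = p * p ^ (k - Suc l)"
    using assms(3) by (metis Suc_diff_le diff_Suc_Suc power_Suc)
  have "block_done p (Suc l) f (?R n) H2"
  proof (rule H2(3))
    fix j
    assume j: "j < p"
    \<comment> \<open>By \<open>block_start_digit\<close>, sub-block \<open>j\<close> of block
      \<open>n\<close> is block \<open>p * n + j\<close> of step \<open>l\<close>.\<close>
    have "p * n + j < p ^ (k - l)"
      using block_index_less[of n "p ^ (k - Suc l)" j p] j Suc.prems unfolding pow
      by (simp add: mult.commute)
    then have "block_done p l f (block_start p l (p * n + j)) H"
      using assms(4) by (simp add: step_done_def)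
    then show "block_done p l f (?R n + j * \<theta> p l) H1"
      using assms(1) j by (simp add: block_done_def block_start_digit same)
  next
    fix u
    have "H (?R n + \<theta> p (Suc l)) u = (if u = 1 then f (?R n + \<theta> p (Suc l) - 1) else 0)"
    proof -
      \<comment> \<open>The last row of block \<open>n\<close> was inactive in step
        \<open>l\<close>: block \<open>b\<close> of that step lies in block \<open>b div p\<close>
        of the new one, which either starts after this row or leaves it free by the strict
        inequality of \<open>block_subset_next_block\<close>.\<close>
      have "?R n + \<theta> p (Suc l) \<le> block_start p l b
          \<or> block_start p l b + \<theta> p l < ?R n + \<theta> p (Suc l)" for b
      proof -
        let ?c = "b div p"
        show ?thesis
        proof (cases "n < ?c")
          case True
          then show ?thesis
            using block_start_less[of n ?c p "Suc l"] block_subset_next_block(1)[OF assms(1), of l b]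
            by linarith
        next
          case False
          then have "?R ?c \<le> ?R n"
            using block_start_less[of ?c n p "Suc l"] by (cases "?c = n") auto
          then show ?thesis using block_subset_next_block(2)[OF assms(1), of l b] by linarith
        qed
      qed
      then show ?thesis using assms(4) by (simp add: step_done_def)
    qed
    then show "H1 (?R n + \<theta> p (Suc l)) u = (if u = 1 then f (?R n + p * \<theta> p l) else 0)"
      using assms(1) by (simp add: same theta_Suc)
  qed
  moreover have "block_done p (Suc l) f (?R b) H2" if "b < n" for b
  proof -
    have "H2 (?R b + i + 1) = H1 (?R b + i + 1)" if "i < \<theta> p (Suc l)" for i
      using block_start_less[OF \<open>b < n\<close>, of p "Suc l"] that by (intro H2(2)) simp
    then show ?thesis using H1(2)[OF \<open>b < n\<close>] by (simp add: block_done_def)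
  qed
  moreover have "update_blocks p (Suc l) [0..<Suc n] (H, c)
      = (H2, c + Suc n * (p\<^sup>2 * \<theta> p (Suc l) + \<theta> p l))"
    using H1(1) H2(1) by (simp add: update_blocks_def add.assoc add.commute add.left_commute)
  moreover have "H2 x = H x"
    if "\<forall>b<Suc n. x \<le> ?R b \<or> ?R b + \<theta> p (Suc l) < x" for x
  proof -
    have "H2 x = H1 x" using that by (intro H2(2)) simp
    also have "\<dots> = H x" using that by (intro H1(3)) simp
    finally show ?thesis .
  qed
  ultimately show ?case by (auto simp: less_Suc_eq)
qed

text \<open>By the nesting, a row outside all blocks of the new step is outside all blocks of the
  old one, so its initial value carries over.\<close>

lemma step_spec:
  assumes "2 \<le> p" "1 \<le> l" "Suc l \<le> k" "step_done p k l f H"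
  shows "\<exists>H'. step p k (Suc l) (H, c)
      = (H', c + p ^ (k - Suc l) * (p\<^sup>2 * \<theta> p (Suc l) + \<theta> p l)) \<and> step_done p k (Suc l) f H'"
proof -
  let ?R = "block_start p (Suc l)"
  obtain H' where H': "update_blocks p (Suc l) [0..<p ^ (k - Suc l)] (H, c)
      = (H', c + p ^ (k - Suc l) * (p\<^sup>2 * \<theta> p (Suc l) + \<theta> p l))"
    "\<forall>b<p ^ (k - Suc l). block_done p (Suc l) f (?R b) H'"
    "\<And>x. \<forall>b<p ^ (k - Suc l). x \<le> ?R b \<or> ?R b + \<theta> p (Suc l) < x \<Longrightarrow> H' x = H x"
    using update_blocks_spec[OF assms order_refl, of c] by blast
  have pow: "p ^ (k - l) = p * p ^ (k - Suc l)"
    using assms(3) by (metis Suc_diff_le diff_Suc_Suc power_Suc)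
  have "H' x u = (if u = 1 then f (x - 1) else 0)"
    if out: "\<forall>b<p ^ (k - Suc l). x \<le> ?R b \<or> ?R b + \<theta> p (Suc l) < x" for x u
  proof -
    have "x \<le> block_start p l b \<or> block_start p l b + \<theta> p l < x" if "b < p ^ (k - l)" for b
    proof -
      have "b div p < p ^ (k - Suc l)"
        using that unfolding pow by (simp add: less_mult_imp_div_less mult.commute)
      then have "x \<le> ?R (b div p) \<or> ?R (b div p) + \<theta> p (Suc l) < x"
        using out by blast
      then show ?thesis using block_subset_next_block[OF assms(1), of l b] by linarith
    qed
    then have "H x u = (if u = 1 then f (x - 1) else 0)"
      using assms(4) by (simp add: step_done_def)
    then show ?thesis using H'(3)[OF out] by simp
  qed
  then show ?thesis
    using H'(1,2) assms(1,3) by (simp add: step_eq_update_blocks step_done_def)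
qed

section \<open>The whole run: its result and exact operation count\<close>

lemma run_spec:
  assumes "2 \<le> p" "1 \<le> k"
  shows "\<exists>H. run p k \<chi> = (H, \<Sum>l = 2..k. p ^ (k - l) * (p\<^sup>2 * \<theta> p l + \<theta> p (l - 1))) \<and>
    step_done p k k (vec_index \<chi>) H"
proof -
  have "\<exists>H. fold (step p k) [2..<m + 1] (init_rows \<chi>, 0)
      = (H, \<Sum>l = 2..m. p ^ (k - l) * (p\<^sup>2 * \<theta> p l + \<theta> p (l - 1))) \<and>
    step_done p k m (vec_index \<chi>) H" if "1 \<le> m" "m \<le> k" for m
    using that
  proof (induction m rule: nat_induct_at_least)
    case base
    \<comment> \<open>For \<open>l = 1\<close> a block is a single row and \<open>M\<close> is the
      matrix (1), so the initial array is already correct.\<close>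
    have "step_done p k 1 (vec_index \<chi>) (init_rows \<chi>)"
      using assms(1) by (auto simp: step_done_def block_done_def init_rows_def theta_1
          char_row_def M_1)
    then show ?case by simp
  next
    case (Suc m)
    then obtain H where H: "fold (step p k) [2..<m + 1] (init_rows \<chi>, 0)
        = (H, \<Sum>l = 2..m. p ^ (k - l) * (p\<^sup>2 * \<theta> p l + \<theta> p (l - 1)))"
      "step_done p k m (vec_index \<chi>) H"
      by auto
    have "[2..<Suc m + 1] = [2..<m + 1] @ [Suc m]" using Suc.hyps by simp
    then show ?case
      using H(1) step_spec[OF assms(1) Suc.hyps Suc.prems H(2)] Suc.hyps by simp
  qed
  from this[of k] show ?thesis using assms(2) by (simp add: run_def)
qed

text \<open>After step \<open>k\<close> there is a single block; it starts at 0 and fills the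
  array.\<close>

lemma procedure_result_eq:
  assumes "2 \<le> p" "1 \<le> k"
  shows "procedure_result p k \<chi> = M_char p k \<chi>"
proof -
  have "step_done p k k (vec_index \<chi>) (fst (run p k \<chi>))"
    using run_spec[OF assms, of \<chi>] by auto
  then show ?thesis
    unfolding M_char_eq procedure_result_def
    by (intro cong_mat) (auto simp: step_done_def block_done_def)
qed

lemma complexity_eq:
  assumes "2 \<le> p" "1 \<le> k"
  shows "real (complexity p k \<chi>) =
    (\<Sum>l = 2..k. (real p ^ (k + 2) - real p ^ (k + 2 - l)
      + real p ^ (k - 1) - real p ^ (k - l)) / (real p - 1))"
proof -
  have "complexity p k \<chi> = (\<Sum>l = 2..k. p ^ (k - l) * (p\<^sup>2 * \<theta> p l + \<theta> p (l - 1)))"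
    using run_spec[OF assms, of \<chi>] by (auto simp: complexity_def)
  then have "real (complexity p k \<chi>)
      = (\<Sum>l = 2..k. real p ^ (k - l) * (real p ^ 2 * real (\<theta> p l) + real (\<theta> p (l - 1))))"
    by simp
  also have "\<dots> = (\<Sum>l = 2..k. (real p ^ (k + 2) - real p ^ (k + 2 - l)
      + real p ^ (k - 1) - real p ^ (k - l)) / (real p - 1))"
  proof (rule sum.cong)
    fix l
    assume l2: "l \<in> {2..k}"
    \<comment> \<open>Writing \<open>l\<close> and \<open>k\<close> as sums removes truncated
      subtraction from the exponents.\<close>
    obtain n m where l: "l = Suc (Suc m)" and k: "k = l + n"
      by (rule that[of "l - 2" "k - l"]) (use l2 in auto)
    have "real p ^ (k - l) * (real p ^ 2 * (real p ^ l - 1) + (real p ^ (l - 1) - 1))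
        = real p ^ (k + 2) - real p ^ (k + 2 - l) + real p ^ (k - 1) - real p ^ (k - l)"
      by (simp add: k l algebra_simps power_add power2_eq_square)
    then show "real p ^ (k - l) * (real p ^ 2 * real (\<theta> p l) + real (\<theta> p (l - 1))) =
      (real p ^ (k + 2) - real p ^ (k + 2 - l)
      + real p ^ (k - 1) - real p ^ (k - l)) / (real p - 1)"
      unfolding real_theta[OF assms(1)]
      by (simp only: times_divide_eq_right add_divide_distrib[symmetric])
  qed simp
  finally show ?thesis .
qed

section \<open>Closed form and asymptotic bounds\<close>

text \<open>A summand is a constant minus a multiple of \<open>p ^ (k - l)\<close>: the constant
  occurs \<open>k - 1\<close> times, and the rest is a geometric series.\<close>

lemma complexity_sum_closed:
  assumes "2 \<le> p" "1 \<le> k"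
  shows "(\<Sum>l = 2..k. (real p ^ (k + 2) - real p ^ (k + 2 - l)
      + real p ^ (k - 1) - real p ^ (k - l)) / (real p - 1)) =
    (real k - 1) * ((real p ^ (k + 2) + real p ^ (k - 1)) / (real p - 1))
      - (real p ^ 2 + 1) * (real p ^ (k - 1) - 1) / (real p - 1) ^ 2"
proof -
  define q where "q = real p"
  have q: "q - 1 \<noteq> 0" using assms(1) by (simp add: q_def)
  obtain n where k: "k = Suc n" using assms(2) by (cases k) auto
  have geo: "(\<Sum>l = 2..k. q ^ (k - l)) = (q ^ n - 1) / (q - 1)"
  proof -
    have "(\<Sum>l = 2..k. q ^ (k - l)) = (\<Sum>j<n. q ^ j)"
      by (rule sum.reindex_bij_witness[of _ "\<lambda>j. k - j" "\<lambda>l. k - l"]) (auto simp: k)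
    then show ?thesis using q by (simp add: geometric_sum)
  qed
  have "(\<Sum>l = 2..k. (q ^ (k + 2) - q ^ (k + 2 - l) + q ^ (k - 1) - q ^ (k - l)) / (q - 1))
      = (\<Sum>l = 2..k. (q ^ (k + 2) + q ^ (k - 1)) / (q - 1) - (q\<^sup>2 + 1) / (q - 1) * q ^ (k - l))"
  proof (rule sum.cong)
    fix l
    assume "l \<in> {2..k}"
    then have "k + 2 - l = (k - l) + 2" by auto
    then have "q ^ (k + 2) - q ^ (k + 2 - l) + q ^ (k - 1) - q ^ (k - l)
        = (q ^ (k + 2) + q ^ (k - 1)) - (q\<^sup>2 + 1) * q ^ (k - l)"
      by (simp only: power_add) (simp add: algebra_simps)
    then show "(q ^ (k + 2) - q ^ (k + 2 - l) + q ^ (k - 1) - q ^ (k - l)) / (q - 1)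
      = (q ^ (k + 2) + q ^ (k - 1)) / (q - 1) - (q\<^sup>2 + 1) / (q - 1) * q ^ (k - l)"
      by (simp only: diff_divide_distrib times_divide_eq_left)
  qed simp
  also have "\<dots> = real n * ((q ^ (k + 2) + q ^ (k - 1)) / (q - 1))
      - (q\<^sup>2 + 1) / (q - 1) * ((q ^ n - 1) / (q - 1))"
    unfolding sum_subtractf sum_distrib_left[symmetric] geo by (simp add: k)
  finally show ?thesis by (simp add: q_def k power2_eq_square)
qed

text \<open>One constant for all \<open>p\<close> and \<open>k\<close>, so that both asymptotic
  claims follow from it.\<close>

lemma complexity_le:
  assumes "2 \<le> p" "1 \<le> k"
  shows "real (complexity p k \<chi>) \<le> 4 * (real k * real p ^ (k + 1))"
proof -
  have p: "real p \<ge> 2" using assms(1) by simp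
  have "(real p ^ (k + 2) - real p ^ (k + 2 - l) + real p ^ (k - 1) - real p ^ (k - l))
      / (real p - 1) \<le> 4 * real p ^ (k + 1)" for l
  proof -
    have "real p ^ (k + 2) - real p ^ (k + 2 - l) + real p ^ (k - 1) - real p ^ (k - l)
        \<le> real p ^ (k + 2) + real p ^ (k - 1)"
      using zero_le_power[of "real p" "k + 2 - l"] zero_le_power[of "real p" "k - l"]
      by linarith
    also have "real p ^ (k - 1) \<le> real p ^ (k + 2)"
      using p by (intro power_increasing) auto
    also have "real p ^ (k + 2) + real p ^ (k + 2) = 2 * real p * real p ^ (k + 1)"
      by simp
    \<comment> \<open>Here \<open>2 \<le> p\<close> enters as \<open>p \<le> 2 * (p - 1)\<close>;
      the other factor 2 comes from the two powers bounded by \<open>p ^ (k + 2)\<close>.\<close>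
    also have "\<dots> \<le> 4 * (real p - 1) * real p ^ (k + 1)"
      using p by (intro mult_right_mono) auto
    finally show ?thesis using p by (simp add: field_simps)
  qed
  then have "real (complexity p k \<chi>) \<le> (\<Sum>l = 2..k. 4 * real p ^ (k + 1))"
    unfolding complexity_eq[OF assms] by (intro sum_mono) blast
  also have "\<dots> = 4 * (real (k - 1) * real p ^ (k + 1))" by simp
  also have "\<dots> \<le> 4 * (real k * real p ^ (k + 1))"
    by (intro mult_left_mono mult_right_mono) auto
  finally show ?thesis .
qed

theorem mainTheorem5:
  shows
    "(\<forall>(p::nat) (k::nat) (\<chi>::int vec).
        prime p \<and> 1 \<le> k \<and> \<chi> \<in> carrier_vec (\<theta> p k) \<longrightarrow>
          procedure_result p k \<chi> = M_char p k \<chi> \<and>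
          real (complexity p k \<chi>) =
            (\<Sum>l = 2..k. (real p ^ (k + 2) - real p ^ (k + 2 - l)
                          + real p ^ (k - 1) - real p ^ (k - l)) / (real p - 1)) \<and>
          (\<Sum>l = 2..k. (real p ^ (k + 2) - real p ^ (k + 2 - l)
                          + real p ^ (k - 1) - real p ^ (k - l)) / (real p - 1)) =
            (real k - 1) * ((real p ^ (k + 2) + real p ^ (k - 1)) / (real p - 1))
            - (real p ^ 2 + 1) * (real p ^ (k - 1) - 1) / (real p - 1) ^ 2)
     \<and> (\<forall>(p::nat) (\<chi> :: nat \<Rightarrow> int vec).
          prime p \<and> (\<forall>k. \<chi> k \<in> carrier_vec (\<theta> p k)) \<longrightarrow>
          (\<lambda>k. real (complexity p k (\<chi> k))) \<in> O(\<lambda>k. real k * real p ^ k))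
     \<and> (\<forall>\<chi> :: nat \<Rightarrow> nat \<Rightarrow> int vec.
          (\<forall>p k. prime p \<and> 1 \<le> k \<longrightarrow> \<chi> p k \<in> carrier_vec (\<theta> p k)) \<longrightarrow>
          (\<lambda>(p, k). real (complexity p k (\<chi> p k)))
            \<in> O[principal {(p, k). prime p \<and> 1 \<le> k}](\<lambda>(p, k). real k * real p ^ (k + 1)))"
proof (intro conjI allI impI)
  fix p k :: nat and \<chi> :: "int vec"
  assume "prime p \<and> 1 \<le> k \<and> \<chi> \<in> carrier_vec (\<theta> p k)"
  then have *: "2 \<le> p" "1 \<le> k" by (auto intro: prime_ge_2_nat)
  show "procedure_result p k \<chi> = M_char p k \<chi>"
    by (rule procedure_result_eq[OF *])
  show "real (complexity p k \<chi>) = (\<Sum>l = 2..k. (real p ^ (k + 2) - real p ^ (k + 2 - l)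
      + real p ^ (k - 1) - real p ^ (k - l)) / (real p - 1))"
    by (rule complexity_eq[OF *])
  show "(\<Sum>l = 2..k. (real p ^ (k + 2) - real p ^ (k + 2 - l)
      + real p ^ (k - 1) - real p ^ (k - l)) / (real p - 1)) =
    (real k - 1) * ((real p ^ (k + 2) + real p ^ (k - 1)) / (real p - 1))
      - (real p ^ 2 + 1) * (real p ^ (k - 1) - 1) / (real p - 1) ^ 2"
    by (rule complexity_sum_closed[OF *])
next
  fix p :: nat and \<chi> :: "nat \<Rightarrow> int vec"
  assume "prime p \<and> (\<forall>k. \<chi> k \<in> carrier_vec (\<theta> p k))"
  then have p: "2 \<le> p" by (auto intro: prime_ge_2_nat)
  show "(\<lambda>k. real (complexity p k (\<chi> k))) \<in> O(\<lambda>k. real k * real p ^ k)"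
  \<comment> \<open>For fixed \<open>p\<close> the surplus factor \<open>p\<close> of
    \<open>complexity_le\<close> goes into the constant.\<close>
  proof (rule bigoI[where c = "4 * real p"])
    show "\<forall>\<^sub>F k in sequentially. norm (real (complexity p k (\<chi> k)))
        \<le> 4 * real p * norm (real k * real p ^ k)"
      using eventually_ge_at_top[of 1]
    proof eventually_elim
      case (elim k)
      then show ?case using complexity_le[OF p, of k "\<chi> k"] by (simp add: mult_ac)
    qed
  qed
next
  fix \<chi> :: "nat \<Rightarrow> nat \<Rightarrow> int vec"
  show "(\<lambda>(p, k). real (complexity p k (\<chi> p k)))
      \<in> O[principal {(p, k). prime p \<and> 1 \<le> k}](\<lambda>(p, k). real k * real p ^ (k + 1))"
    \<comment> \<open>Eventually, for a principal filter, means at every pair of the set, so the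
      constant must be uniform in \<open>p\<close> and \<open>k\<close>.\<close>
    using complexity_le
    by (intro bigoI[where c = 4])
      (auto simp: eventually_principal abs_mult prime_ge_2_nat)
qed

end
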